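(* Let $R,S$ be rings, $W$ an $(R,S)$-bimodule, and let $B$ and $C$ be nondegenerate $(R,S)$-bimaps into $W$. For an adjoint-morphism $(\overleftarrow{\mu},\overrightarrow{\mu})\in \mathrm{Adj}(B,C)$ the following are equivalent. (i) $(\ker\overleftarrow{\mu})^{\bot}=\mathrm{im}\,\overrightarrow{\mu}$ and $(\ker\overrightarrow{\mu})^{\top}=\mathrm{im}\,\overleftarrow{\mu}$. (ii) $(\ker\overleftarrow{\mu})^{\bot}\leq\mathrm{im}\,\overrightarrow{\mu}$ and $(\ker\overrightarrow{\mu})^{\top}\leq\mathrm{im}\,\overleftarrow{\mu}$. (iii) $\ker\overleftarrow{\mu}=(\ker\overleftarrow{\mu})^{\bot\top}$, $\mathrm{im}\,\overleftarrow{\mu}=(\mathrm{im}\,\overleftarrow{\mu})^{\bot\top}$, $\ker\overrightarrow{\mu}=(\ker\overrightarrow{\mu})^{\top\bot}$, and $\mathrm{im}\,\overrightarrow{\mu}=(\mathrm{im}\,\overrightarrow{\mu})^{\top\bot}$.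
   Context: Homomorphisms of left $R$-modules are written on the right of their arguments ($u\mu$), homomorphisms of right $S$-modules on the left ($\nu v$). For a left $R$-module $U$ and a right $S$-module $V$, an $(R,S)$-bimap $B:U\times V\to W$, written $uBv$, is a function additive in each variable with $(ru)Bv=r(uBv)$ and $uB(vs)=(uBv)s$ for all $r\in R$, $s\in S$, $u\in U$, $v\in V$. Write $\overleftarrow{B}=U$, $\overrightarrow{B}=V$. An adjoint-morphism from $B$ to another $(R,S)$-bimap $C$ into $W$, i.e. an element of $\mathrm{Adj}(B,C)$, is a pair $(\overleftarrow{\mu},\overrightarrow{\mu})\in\mathrm{Hom}_R(\overleftarrow{B},\overleftarrow{C})\times\mathrm{Hom}_S(\overrightarrow{C},\overrightarrow{B})$ with $(u\overleftarrow{\mu})Cv'=uB(\overrightarrow{\mu}v')$ for all $u\in\overleftarrow{B}$, $v'\in\overrightarrow{C}$. For a bimap $B:U\times V\to W$ and $X\subseteq U$, $Y\subseteq V$: $X^{\bot}=\{v\in V: xBv=0\ \forall x\in X\}$ and $Y^{\top}=\{u\in U: uBy=0\ \forall y\in Y\}$. $B$ is nondegenerate if $U^{\bot}=0$ and $V^{\top}=0$. The operators are taken with respect to the bimap containing the given submodule: for $\ker\overleftarrow{\mu}\leq\overleftarrow{B}$ and $\mathrm{im}\,\overrightarrow{\mu}\leq\overrightarrow{B}$ with respect to $B$; for $\mathrm{im}\,\overleftarrow{\mu}\leq\overleftarrow{C}$ and $\ker\overrightarrow{\mu}\leq\overrightarrow{C}$ with respect to $C$. *)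

theory Defs
  imports "HOL-Algebra.Module" "HOL-Algebra.AbelCoset"
begin

text \<open>
  The library's \<open>module\<close> locale requires a commutative ring of scalars.  Here the rings are
  arbitrary (associative, unital) and modules are unital.  For left modules we reuse the record
  type \<open>('r, 'm) module\<close>; as for that record, the \<open>ring\<close> fields \<open>mult\<close> and \<open>one\<close> of a module
  carry no meaning.
\<close>

locale left_module = R?: ring R + M?: abelian_group M
  for R :: "('r, 'a) ring_scheme" (structure) and M :: "('r, 'm, 'b) module_scheme" (structure) +
  assumes lsmult_closed:
      "\<lbrakk>r \<in> carrier R; x \<in> carrier M\<rbrakk> \<Longrightarrow> r \<odot>\<^bsub>M\<^esub> x \<in> carrier M"
    and lsmult_l_distr:
      "\<lbrakk>r \<in> carrier R; r' \<in> carrier R; x \<in> carrier M\<rbrakk> \<Longrightarrow>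
        (r \<oplus>\<^bsub>R\<^esub> r') \<odot>\<^bsub>M\<^esub> x = r \<odot>\<^bsub>M\<^esub> x \<oplus>\<^bsub>M\<^esub> r' \<odot>\<^bsub>M\<^esub> x"
    and lsmult_r_distr:
      "\<lbrakk>r \<in> carrier R; x \<in> carrier M; y \<in> carrier M\<rbrakk> \<Longrightarrow>
        r \<odot>\<^bsub>M\<^esub> (x \<oplus>\<^bsub>M\<^esub> y) = r \<odot>\<^bsub>M\<^esub> x \<oplus>\<^bsub>M\<^esub> r \<odot>\<^bsub>M\<^esub> y"
    and lsmult_assoc:
      "\<lbrakk>r \<in> carrier R; r' \<in> carrier R; x \<in> carrier M\<rbrakk> \<Longrightarrow>
        (r \<otimes>\<^bsub>R\<^esub> r') \<odot>\<^bsub>M\<^esub> x = r \<odot>\<^bsub>M\<^esub> (r' \<odot>\<^bsub>M\<^esub> x)"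
    and lsmult_one:
      "x \<in> carrier M \<Longrightarrow> \<one>\<^bsub>R\<^esub> \<odot>\<^bsub>M\<^esub> x = x"

text \<open>
  The right action is a separate argument, so that the locale applies both to right modules
  and to bimodules, whose actions are fields of different records.
\<close>

locale right_module = S?: ring S + M?: abelian_group M
  for S :: "('s, 'a) ring_scheme" (structure) and M :: "('m, 'b) ring_scheme" (structure) +
  fixes act :: "'m \<Rightarrow> 's \<Rightarrow> 'm"
  assumes act_closed:
      "\<lbrakk>x \<in> carrier M; s \<in> carrier S\<rbrakk> \<Longrightarrow> act x s \<in> carrier M"
    and act_r_distr:
      "\<lbrakk>x \<in> carrier M; s \<in> carrier S; s' \<in> carrier S\<rbrakk> \<Longrightarrow>
        act x (s \<oplus>\<^bsub>S\<^esub> s') = act x s \<oplus>\<^bsub>M\<^esub> act x s'"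
    and act_l_distr:
      "\<lbrakk>x \<in> carrier M; y \<in> carrier M; s \<in> carrier S\<rbrakk> \<Longrightarrow>
        act (x \<oplus>\<^bsub>M\<^esub> y) s = act x s \<oplus>\<^bsub>M\<^esub> act y s"
    and act_assoc:
      "\<lbrakk>x \<in> carrier M; s \<in> carrier S; s' \<in> carrier S\<rbrakk> \<Longrightarrow>
        act x (s \<otimes>\<^bsub>S\<^esub> s') = act (act x s) s'"
    and act_one:
      "x \<in> carrier M \<Longrightarrow> act x \<one>\<^bsub>S\<^esub> = x"

record ('s, 'm) rmodule = "'m ring" +
  rsmult :: "'m \<Rightarrow> 's \<Rightarrow> 'm"

record ('r, 's, 'm) bimodule = "('r, 'm) module" +
  bi_rsmult :: "'m \<Rightarrow> 's \<Rightarrow> 'm"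

locale bimodule = left_module R W + right_module S W "bi_rsmult W"
  for R :: "('r, 'a) ring_scheme" and S :: "('s, 'b) ring_scheme"
    and W :: "('r, 's, 'w) bimodule" +
  assumes lsmult_act_assoc:
    "\<lbrakk>r \<in> carrier R; s \<in> carrier S; w \<in> carrier W\<rbrakk> \<Longrightarrow>
      bi_rsmult W (r \<odot>\<^bsub>W\<^esub> w) s = r \<odot>\<^bsub>W\<^esub> bi_rsmult W w s"

definition left_hom ::
  "('r, 'a) ring_scheme \<Rightarrow> ('r, 'm) module \<Rightarrow> ('r, 'n) module \<Rightarrow> ('m \<Rightarrow> 'n) set" where
  "left_hom R M N =
    {f \<in> hom (add_monoid M) (add_monoid N).
      \<forall>r\<in>carrier R. \<forall>x\<in>carrier M. f (r \<odot>\<^bsub>M\<^esub> x) = r \<odot>\<^bsub>N\<^esub> f x}"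

definition right_hom ::
  "('s, 'a) ring_scheme \<Rightarrow> ('s, 'm) rmodule \<Rightarrow> ('s, 'n) rmodule \<Rightarrow> ('m \<Rightarrow> 'n) set" where
  "right_hom S M N =
    {f \<in> hom (add_monoid M) (add_monoid N).
      \<forall>x\<in>carrier M. \<forall>s\<in>carrier S. f (rsmult M x s) = rsmult N (f x) s}"

text \<open>
  A bimap \<open>B\<close> carries its two domains: \<open>lmod B\<close> is the left module written as \<open>B\<close> with a left
  arrow on top, \<open>rmod B\<close> the right module with the right arrow, and \<open>bapp B u v\<close> is \<open>uBv\<close>.
\<close>

record ('r, 's, 'u, 'v, 'w) bimap =
  lmod :: "('r, 'u) module"
  rmod :: "('s, 'v) rmodule"
  bapp :: "'u \<Rightarrow> 'v \<Rightarrow> 'w"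

locale bimap =
  bimodule R S W + U: left_module R "lmod B" + V: right_module S "rmod B" "rsmult (rmod B)"
  for R :: "('r, 'a) ring_scheme" and S :: "('s, 'b) ring_scheme"
    and W :: "('r, 's, 'w) bimodule" and B :: "('r, 's, 'u, 'v, 'w) bimap" +
  assumes bapp_closed:
      "\<lbrakk>u \<in> carrier (lmod B); v \<in> carrier (rmod B)\<rbrakk> \<Longrightarrow> bapp B u v \<in> carrier W"
    and bapp_add_left:
      "\<lbrakk>u \<in> carrier (lmod B); u' \<in> carrier (lmod B); v \<in> carrier (rmod B)\<rbrakk> \<Longrightarrow>
        bapp B (u \<oplus>\<^bsub>lmod B\<^esub> u') v = bapp B u v \<oplus>\<^bsub>W\<^esub> bapp B u' v"
    and bapp_add_right:
      "\<lbrakk>u \<in> carrier (lmod B); v \<in> carrier (rmod B); v' \<in> carrier (rmod B)\<rbrakk> \<Longrightarrow>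
        bapp B u (v \<oplus>\<^bsub>rmod B\<^esub> v') = bapp B u v \<oplus>\<^bsub>W\<^esub> bapp B u v'"
    and bapp_smult_left:
      "\<lbrakk>r \<in> carrier R; u \<in> carrier (lmod B); v \<in> carrier (rmod B)\<rbrakk> \<Longrightarrow>
        bapp B (r \<odot>\<^bsub>lmod B\<^esub> u) v = r \<odot>\<^bsub>W\<^esub> bapp B u v"
    and bapp_smult_right:
      "\<lbrakk>u \<in> carrier (lmod B); v \<in> carrier (rmod B); s \<in> carrier S\<rbrakk> \<Longrightarrow>
        bapp B u (rsmult (rmod B) v s) = bi_rsmult W (bapp B u v) s"

definition Adj ::
  "('r, 'a) ring_scheme \<Rightarrow> ('s, 'b) ring_scheme \<Rightarrow>
   ('r, 's, 'u, 'v, 'w) bimap \<Rightarrow> ('r, 's, 'u2, 'v2, 'w) bimap \<Rightarrow> (('u \<Rightarrow> 'u2) \<times> ('v2 \<Rightarrow> 'v)) set"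
  where
  "Adj R S B C =
    {(\<mu>, \<nu>) \<in> left_hom R (lmod B) (lmod C) \<times> right_hom S (rmod C) (rmod B).
      \<forall>u\<in>carrier (lmod B). \<forall>v'\<in>carrier (rmod C). bapp C (\<mu> u) v' = bapp B u (\<nu> v')}"

definition perp_bot ::
  "('r, 's, 'w) bimodule \<Rightarrow> ('r, 's, 'u, 'v, 'w) bimap \<Rightarrow> 'u set \<Rightarrow> 'v set" where
  "perp_bot W B X = {v \<in> carrier (rmod B). \<forall>x\<in>X. bapp B x v = \<zero>\<^bsub>W\<^esub>}"

definition perp_top ::
  "('r, 's, 'w) bimodule \<Rightarrow> ('r, 's, 'u, 'v, 'w) bimap \<Rightarrow> 'v set \<Rightarrow> 'u set" where
  "perp_top W B Y = {u \<in> carrier (lmod B). \<forall>y\<in>Y. bapp B u y = \<zero>\<^bsub>W\<^esub>}"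

definition nondegenerate ::
  "('r, 's, 'w) bimodule \<Rightarrow> ('r, 's, 'u, 'v, 'w) bimap \<Rightarrow> bool" where
  "nondegenerate W B \<longleftrightarrow>
    perp_bot W B (carrier (lmod B)) = {\<zero>\<^bsub>rmod B\<^esub>} \<and>
    perp_top W B (carrier (rmod B)) = {\<zero>\<^bsub>lmod B\<^esub>}"

end

theory Submission
  imports Defs
begin

text \<open>
  The perp operators \<open>\<bottom>\<close> and \<open>\<top>\<close> of a bimap form an antitone Galois connection between subsets of
  its two modules, so every perp is closed under the double perp.  Nondegeneracy allows vanishing of
  an element to be tested by pairing it with the whole other module, and the adjoint identity
  then turns each kernel into the perp of the image of the adjoint partner: \<open>ker \<mu>l = (im \<mu>r)\<^sup>\<top>\<close> in \<open>B\<close>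
  (lemma \<open>left_kernel_eq_perp_top_image\<close>) and \<open>ker \<mu>r = (im \<mu>l)\<^sup>\<bottom>\<close> in \<open>C\<close>
  (lemma \<open>right_kernel_eq_perp_bot_image\<close>).

  Therefore the two kernels are closed, \<open>(ker \<mu>l)\<^sup>\<bottom>\<close> is the double perp of
  \<open>im \<mu>r\<close>, and \<open>(ker \<mu>r)\<^sup>\<top>\<close> is the double perp of \<open>im \<mu>l\<close>.  Each of the three conditions thus says
  that both images are closed; the passage from inclusion to equality holds because a set
  always lies in its double perp.
\<close>

lemma subset_perp_bot_perp_top:
  "Y \<subseteq> carrier (rmod B) \<Longrightarrow> Y \<subseteq> perp_bot W B (perp_top W B Y)"
  by (auto simp: perp_bot_def perp_top_def)

lemma subset_perp_top_perp_bot: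
  "X \<subseteq> carrier (lmod B) \<Longrightarrow> X \<subseteq> perp_top W B (perp_bot W B X)"
  by (auto simp: perp_bot_def perp_top_def)

lemma perp_top_perp_bot_perp_top:
  "Y \<subseteq> carrier (rmod B) \<Longrightarrow> perp_top W B (perp_bot W B (perp_top W B Y)) = perp_top W B Y"
  by (auto simp: perp_bot_def perp_top_def)

lemma perp_bot_perp_top_perp_bot:
  "X \<subseteq> carrier (lmod B) \<Longrightarrow> perp_bot W B (perp_top W B (perp_bot W B X)) = perp_bot W B X"
  by (auto simp: perp_bot_def perp_top_def)

lemma nondegenerate_left_eq_zero_iff:
  assumes "nondegenerate W B" and "u \<in> carrier (lmod B)"
  shows "u = \<zero>\<^bsub>lmod B\<^esub> \<longleftrightarrow> (\<forall>v\<in>carrier (rmod B). bapp B u v = \<zero>\<^bsub>W\<^esub>)"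
proof -
  have "u \<in> perp_top W B (carrier (rmod B)) \<longleftrightarrow> u = \<zero>\<^bsub>lmod B\<^esub>"
    using assms(1) by (simp add: nondegenerate_def)
  then show ?thesis
    using assms(2) by (simp add: perp_top_def)
qed

lemma nondegenerate_right_eq_zero_iff:
  assumes "nondegenerate W B" and "v \<in> carrier (rmod B)"
  shows "v = \<zero>\<^bsub>rmod B\<^esub> \<longleftrightarrow> (\<forall>u\<in>carrier (lmod B). bapp B u v = \<zero>\<^bsub>W\<^esub>)"
proof -
  have "v \<in> perp_bot W B (carrier (lmod B)) \<longleftrightarrow> v = \<zero>\<^bsub>rmod B\<^esub>"
    using assms(1) by (simp add: nondegenerate_def)
  then show ?thesis
    using assms(2) by (simp add: perp_bot_def)
qed

lemma Adj_left_closed: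
  "\<lbrakk>(\<mu>l, \<mu>r) \<in> Adj R S B C; u \<in> carrier (lmod B)\<rbrakk> \<Longrightarrow> \<mu>l u \<in> carrier (lmod C)"
  by (auto simp: Adj_def left_hom_def hom_def)

lemma Adj_right_closed:
  "\<lbrakk>(\<mu>l, \<mu>r) \<in> Adj R S B C; v \<in> carrier (rmod C)\<rbrakk> \<Longrightarrow> \<mu>r v \<in> carrier (rmod B)"
  by (auto simp: Adj_def right_hom_def hom_def)

lemma Adj_adjoint:
  "\<lbrakk>(\<mu>l, \<mu>r) \<in> Adj R S B C; u \<in> carrier (lmod B); v \<in> carrier (rmod C)\<rbrakk> \<Longrightarrow>
    bapp C (\<mu>l u) v = bapp B u (\<mu>r v)"
  by (auto simp: Adj_def)

text \<open>
  Nondegeneracy of \<open>C\<close> tests \<open>\<mu>l u = 0\<close> by pairing with all \<open>v\<close> on the right, and the adjoint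
  identity moves these pairings into \<open>B\<close>, where \<open>u\<close> is paired with the image of \<open>\<mu>r\<close>.
\<close>

lemma left_kernel_eq_perp_top_image:
  assumes adj: "(\<mu>l, \<mu>r) \<in> Adj R S B C" and nd: "nondegenerate W C"
  shows "a_kernel (lmod B) (lmod C) \<mu>l = perp_top W B (\<mu>r ` carrier (rmod C))"
proof -
  have "\<mu>l u = \<zero>\<^bsub>lmod C\<^esub> \<longleftrightarrow> (\<forall>v\<in>carrier (rmod C). bapp B u (\<mu>r v) = \<zero>\<^bsub>W\<^esub>)"
    if "u \<in> carrier (lmod B)" for u
    using that by (simp add: nondegenerate_left_eq_zero_iff[OF nd] Adj_left_closed[OF adj] Adj_adjoint[OF adj])
  then show ?thesis
    by (auto simp: a_kernel_def' perp_top_def)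
qed

text \<open>
  Since \<open>\<mu>r\<close> maps from \<open>C\<close> back to \<open>B\<close>, vanishing is now tested in \<open>B\<close>, and the adjoint identity is
  read from right to left.
\<close>

lemma right_kernel_eq_perp_bot_image:
  assumes adj: "(\<mu>l, \<mu>r) \<in> Adj R S B C" and nd: "nondegenerate W B"
  shows "a_kernel (rmod C) (rmod B) \<mu>r = perp_bot W C (\<mu>l ` carrier (lmod B))"
proof -
  have "\<mu>r v = \<zero>\<^bsub>rmod B\<^esub> \<longleftrightarrow> (\<forall>u\<in>carrier (lmod B). bapp C (\<mu>l u) v = \<zero>\<^bsub>W\<^esub>)"
    if "v \<in> carrier (rmod C)" for v
    using that by (simp add: nondegenerate_right_eq_zero_iff[OF nd] Adj_right_closed[OF adj] Adj_adjoint[OF adj])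
  then show ?thesis
    by (auto simp: a_kernel_def' perp_bot_def)
qed

theorem proposition3p3:
  fixes R :: "('r, 'a) ring_scheme" and S :: "('s, 'b) ring_scheme"
    and W :: "('r, 's, 'w) bimodule"
    and B :: "('r, 's, 'u, 'v, 'w) bimap" and C :: "('r, 's, 'u2, 'v2, 'w) bimap"
    and \<mu>l :: "'u \<Rightarrow> 'u2" and \<mu>r :: "'v2 \<Rightarrow> 'v"
  assumes "ring R" and "ring S" and "bimodule R S W"
    and "bimap R S W B" and "nondegenerate W B"
    and "bimap R S W C" and "nondegenerate W C"
    and "(\<mu>l, \<mu>r) \<in> Adj R S B C"
  defines "ker_l \<equiv> a_kernel (lmod B) (lmod C) \<mu>l"
    and "im_l \<equiv> \<mu>l ` carrier (lmod B)"
    and "ker_r \<equiv> a_kernel (rmod C) (rmod B) \<mu>r"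
    and "im_r \<equiv> \<mu>r ` carrier (rmod C)"
  defines "i \<equiv> perp_bot W B ker_l = im_r \<and> perp_top W C ker_r = im_l"
    and "ii \<equiv> perp_bot W B ker_l \<subseteq> im_r \<and> perp_top W C ker_r \<subseteq> im_l"
    and "iii \<equiv>
      ker_l = perp_top W B (perp_bot W B ker_l) \<and>
      im_l = perp_top W C (perp_bot W C im_l) \<and>
      ker_r = perp_bot W C (perp_top W C ker_r) \<and>
      im_r = perp_bot W B (perp_top W B im_r)"
  shows "(i \<longleftrightarrow> ii) \<and> (ii \<longleftrightarrow> iii)"
proof -
  note adj = \<open>(\<mu>l, \<mu>r) \<in> Adj R S B C\<close>
  have im_l_carrier: "im_l \<subseteq> carrier (lmod C)" and im_r_carrier: "im_r \<subseteq> carrier (rmod B)"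
    unfolding im_l_def im_r_def by (auto intro: Adj_left_closed[OF adj] Adj_right_closed[OF adj])
  have ker_l: "ker_l = perp_top W B im_r"
    unfolding ker_l_def im_r_def
    by (rule left_kernel_eq_perp_top_image[OF adj \<open>nondegenerate W C\<close>])
  have ker_r: "ker_r = perp_bot W C im_l"
    unfolding ker_r_def im_l_def
    by (rule right_kernel_eq_perp_bot_image[OF adj \<open>nondegenerate W B\<close>])
  have "im_r \<subseteq> perp_bot W B ker_l" and "im_l \<subseteq> perp_top W C ker_r"
    unfolding ker_l ker_r
    by (rule subset_perp_bot_perp_top[OF im_r_carrier], rule subset_perp_top_perp_bot[OF im_l_carrier])
  then have "i \<longleftrightarrow> ii"
    unfolding i_def ii_def by blast
  moreover have "ker_l = perp_top W B (perp_bot W B ker_l)"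
      and "ker_r = perp_bot W C (perp_top W C ker_r)"
    unfolding ker_l ker_r
    by (simp_all add: perp_top_perp_bot_perp_top[OF im_r_carrier] perp_bot_perp_top_perp_bot[OF im_l_carrier])
  (* What is left of the third condition is closedness of the two images, which ker_l and
     ker_r identify with the equalities of the first condition. *)
  then have "iii \<longleftrightarrow> i"
    unfolding i_def iii_def ker_l[symmetric] ker_r[symmetric] by auto
  ultimately show ?thesis by blast
qed

end
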